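(* $\mathcal{F}_{GP_d}=\mathcal{F}_{SGP_d}$ for each $d\in \mathbb{N}$.
   Context: $\mathbb{N}$ denotes the positive integers. For $a\in\mathbb{R}$ let $\|a\|=\inf\{|a-n|:n\in\mathbb{Z}\}$ and $\lceil a\rceil=\min\{m\in\mathbb{Z}:|a-m|=\|a\|\}$ (nearest integer). Generalized polynomials of degree $\le d$, denoted $GP_d$, are defined by induction. $GP_1$ is the smallest collection of functions $\mathbb{Z}\to\mathbb{R}$ containing all $n\mapsto an$ ($a\in\mathbb{R}$) and closed under $f\mapsto\lceil f\rceil$, multiplication by real constants, and finite sums. For $d\ge2$, $GP_d$ is the smallest collection of functions $\mathbb{Z}\to\mathbb{R}$ containing $GP_i$ for all $i<d$ and all functions $n\mapsto a_0n^{p_0}\lceil f_1(n)\rceil\cdots\lceil f_k(n)\rceil$ (with $a_0\in\mathbb{R}$, $p_0\ge0$, $k\ge0$, $f_l\in GP_{p_l}$ with $p_l\ge 1$ for $1\le l\le k$, and $\sum_{l=0}^kp_l=d$), and closed under $f\mapsto\lceil f\rceil$, multiplication by real constants, and finite sums. For reals define $L(a_1)=a_1$ and $L(a_1,\dots,a_\ell)=a_1\lceil L(a_2,\dots,a_\ell)\rceil$ for $\ell\ge2$. Special generalized polynomials of degree $\le d$, denoted $SGP_d$, are the functions $n\mapsto L(n^{j_1}a_1,\dots,n^{j_\ell}a_\ell)$ with $1\le\ell\le d$, $a_1,\dots,a_\ell\in\mathbb{R}$, $j_1,\dots,j_\ell\in\mathbb{N}$, $\sum_{t=1}^\ell j_t\le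 d$. $\mathcal{F}_{GP_d}$ (resp. $\mathcal{F}_{SGP_d}$) is the collection of all $A\subset\mathbb{Z}$ containing some set $\bigcap_{i=1}^k\{n\in\mathbb{Z}:\|P_i(n)\|<\epsilon_i\}$ with $k\in\mathbb{N}$, $P_i\in GP_d$ (resp. $P_i\in SGP_d$), $\epsilon_i>0$. *)

theory Defs
  imports Complex_Main
begin

definition int_dist :: "real \<Rightarrow> real" where
  "int_dist a = (INF n::int. \<bar>a - of_int n\<bar>)"

(* Ties go to the smaller integer, unlike the library function round. *)
definition nint :: "real \<Rightarrow> int" where
  "nint a = (LEAST m::int. \<bar>a - of_int m\<bar> = int_dist a)"

(* GP_poly d f: f is a generalized polynomial of degree at most d. The least family defined
   by simultaneous induction on all degrees agrees with the collections defined successively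
   for d = 1, 2, ..., since no rule concluding at degree d refers to a degree above d. There are no
   members at degree 0. Closure under binary sums gives all finite sums; the empty sum arises
   from scaling by 0. *)
inductive GP_poly :: "nat \<Rightarrow> (int \<Rightarrow> real) \<Rightarrow> bool" where
  linear: "GP_poly 1 (\<lambda>n. a * of_int n)"
| lower: "\<lbrakk>GP_poly i f; i < d\<rbrakk> \<Longrightarrow> GP_poly d f"
| product:
    "\<lbrakk>d \<ge> 2; \<forall>l\<in>{1..k::nat}. p l \<ge> 1 \<and> GP_poly (p l) (f l); (\<Sum>l=0..k. p l) = d\<rbrakk>
     \<Longrightarrow> GP_poly d (\<lambda>n. a * of_int n ^ p 0 * (\<Prod>l=1..k. of_int (nint (f l n))))"
| nearest: "GP_poly d f \<Longrightarrow> GP_poly d (\<lambda>n. of_int (nint (f n)))"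
| scale: "GP_poly d f \<Longrightarrow> GP_poly d (\<lambda>n. c * f n)"
| add: "\<lbrakk>GP_poly d f; GP_poly d g\<rbrakk> \<Longrightarrow> GP_poly d (\<lambda>n. f n + g n)"

definition GP :: "nat \<Rightarrow> (int \<Rightarrow> real) set" where
  "GP d = {f. GP_poly d f}"

(* The value at the empty list is irrelevant: only nonempty lists are used. *)
fun nested :: "real list \<Rightarrow> real" where
  "nested [] = 0"
| "nested [a] = a"
| "nested (a # b # as) = a * of_int (nint (nested (b # as)))"

definition SGP :: "nat \<Rightarrow> (int \<Rightarrow> real) set" where
  "SGP d = {(\<lambda>n. nested (map2 (\<lambda>j a. of_int n ^ j * a) js as)) | js as.
     length js = length as \<and> 1 \<le> length as \<and> length as \<le> d \<and>
     (\<forall>j\<in>set js. j \<ge> 1) \<and> sum_list js \<le> d}"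

definition family_of :: "(int \<Rightarrow> real) set \<Rightarrow> int set set" where
  "family_of C = {A. \<exists>(k::nat) P \<epsilon>. k \<ge> 1 \<and> (\<forall>i\<in>{1..k}. P i \<in> C \<and> \<epsilon> i > 0) \<and>
     (\<Inter>i\<in>{1..k}. {n. int_dist (P i n) < \<epsilon> i}) \<subseteq> A}"

definition F_GP :: "nat \<Rightarrow> int set set" where
  "F_GP d = family_of (GP d)"

definition F_SGP :: "nat \<Rightarrow> int set set" where
  "F_SGP d = family_of (SGP d)"

end

theory Submission
  imports Defs
begin

text \<open>
  Write \<open>\<lceil>x\<rceil>\<close> for the nearest integer and \<open>o(1)\<close> for functions tending to \<open>0\<close> along the filter
  generated by the sets \<open>{n. \<parallel>s(n)\<parallel> < \<epsilon>}\<close>, \<open>s \<in> SGP\<^sub>d\<close>. The core is that every real multiple of a product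
  \<open>u = n\<^sup>j \<lceil>s\<^sub>1\<rceil> \<dots> \<lceil>s\<^sub>m\<rceil>\<close> of total degree \<open>d\<close>, with special \<open>s\<^sub>i\<close>, is \<open>e + o(1)\<close>, where \<open>e\<close> is an integer
  combination of products of at most \<open>m\<close> brackets \<open>\<lceil>s\<rceil>\<close> of special \<open>s\<close> and has degree at most \<open>d\<close>.
  To see this, write \<open>c u = V \<lceil>w\<rceil>\<close> with \<open>w = s\<^sub>m\<close>. Inductively \<open>V = e' + o(1)\<close>, so
  \<open>(V - e') (w - \<lceil>w\<rceil>) = o(1)\<close> gives \<open>V \<lceil>w\<rceil> = V w + e' \<lceil>w\<rceil> - e' w + o(1)\<close>. Since \<open>w\<close> is \<open>b n\<^sup>i\<close> or
  \<open>b n\<^sup>i \<lceil>t\<rceil>\<close>, the terms \<open>V w\<close> and \<open>e' w\<close> have either fewer brackets or a less deeply nested last one.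
  By induction on the construction of generalized polynomials, each \<open>f \<in> GP\<^sub>d\<close> is then \<open>e + o(1)\<close> with
  \<open>e\<close> integer valued, hence \<open>\<parallel>f\<parallel>\<close> tends to \<open>0\<close>.
\<close>

section \<open>Nearest integers\<close>

lemma int_dist_eq_round: "int_dist a = \<bar>a - of_int (round a)\<bar>"
  unfolding int_dist_def
proof (rule antisym)
  show "(INF n::int. \<bar>a - of_int n\<bar>) \<le> \<bar>a - of_int (round a)\<bar>"
    by (rule cINF_lower) (auto intro: bdd_belowI[of _ 0])
  show "\<bar>a - of_int (round a)\<bar> \<le> (INF n::int. \<bar>a - of_int n\<bar>)"
    by (rule cINF_greatest) (use round_diff_minimal[of a] in auto)
qed

lemma int_dist_le: "int_dist a \<le> \<bar>a - of_int m\<bar>"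
  unfolding int_dist_eq_round by (rule round_diff_minimal)

lemma int_dist_nonneg: "0 \<le> int_dist a"
  by (simp add: int_dist_eq_round)

lemma int_dist_le_half: "int_dist a \<le> 1 / 2"
  unfolding int_dist_eq_round using of_int_round_abs_le[of a] by (simp add: abs_minus_commute)

text \<open>The integers attaining the distance lie within 1/2 of \<open>a\<close>, so they form a
  finite nonempty set and the \<open>LEAST\<close> in \<open>nint\<close> is its minimum. The choice
  at ties never matters below.\<close>

lemma abs_diff_nint: "\<bar>a - of_int (nint a)\<bar> = int_dist a"
proof -
  let ?P = "\<lambda>m::int. \<bar>a - of_int m\<bar> = int_dist a"
  have "{m. ?P m} \<subseteq> {\<lfloor>a\<rfloor> - 1..\<lfloor>a\<rfloor> + 1}"
  proof
    fix m assume "m \<in> {m. ?P m}"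
    then have "\<bar>a - of_int m\<bar> \<le> 1 / 2"
      using int_dist_le_half[of a] by simp
    then have "\<lfloor>a\<rfloor> - 1 \<le> m" "m \<le> \<lfloor>a\<rfloor> + 1" by linarith+
    then show "m \<in> {\<lfloor>a\<rfloor> - 1..\<lfloor>a\<rfloor> + 1}" by simp
  qed
  then have fin: "finite {m. ?P m}"
    by (rule finite_subset) simp
  have ex: "?P (round a)"
    by (simp add: int_dist_eq_round)
  have "nint a = Min {m. ?P m}"
    unfolding nint_def using fin ex by (intro Least_Min) auto
  moreover have "Min {m. ?P m} \<in> {m. ?P m}"
    using fin ex by (intro Min_in) auto
  ultimately show ?thesis by simp
qed

lemma nint_unique:
  assumes "\<bar>a - of_int m\<bar> < 1 / 2"
  shows "nint a = m"
proof -
  have "\<bar>a - of_int (nint a)\<bar> < 1 / 2"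
    using assms int_dist_le[of a m] by (simp add: abs_diff_nint)
  with assms have "\<bar>real_of_int (nint a) - of_int m\<bar> < 1"
    by linarith
  then show ?thesis by linarith
qed

section \<open>Special generalized polynomials\<close>

text \<open>An inductive form of \<open>SGP d\<close> that peels off the outermost factor. The index
  only bounds the degree; all slack sits in the innermost monomial.\<close>

inductive special_poly :: "nat \<Rightarrow> (int \<Rightarrow> real) \<Rightarrow> bool" where
  monomial: "1 \<le> j \<Longrightarrow> j \<le> d \<Longrightarrow> special_poly d (\<lambda>n. of_int n ^ j * a)"
| nest: "1 \<le> j \<Longrightarrow> special_poly d s \<Longrightarrow>
    special_poly (j + d) (\<lambda>n. of_int n ^ j * a * of_int (nint (s n)))"

lemma special_poly_pos: "special_poly d s \<Longrightarrow> 1 \<le> d"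
  by (induction rule: special_poly.induct) auto

lemma special_poly_mono: "special_poly d s \<Longrightarrow> d \<le> d' \<Longrightarrow> special_poly d' s"
proof (induction arbitrary: d' rule: special_poly.induct)
  case (monomial j d a)
  then show ?case by (intro special_poly.monomial) auto
next
  case (nest j d s a)
  then have "special_poly (j + (d' - j)) (\<lambda>n. of_int n ^ j * a * of_int (nint (s n)))"
    by (intro special_poly.nest) auto
  with nest.prems show ?case by simp
qed

lemma special_poly_scale: "special_poly d s \<Longrightarrow> special_poly d (\<lambda>n. c * s n)"
proof (induction rule: special_poly.cases)
  case (monomial j d a)
  then show ?case using special_poly.monomial[of j d "a * c"] by (simp add: mult_ac)
next
  case (nest j d s a)
  then show ?case using special_poly.nest[of j d s "a * c"] by (simp add: mult_ac)
qed

lemma nested_Cons: "as \<noteq> [] \<Longrightarrow> nested (a # as) = a * of_int (nint (nested as))"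
  by (cases as) auto

lemma special_poly_imp_SGP: "special_poly d s \<Longrightarrow> s \<in> SGP d"
proof (induction rule: special_poly.induct)
  case (monomial j d a)
  then show ?case
    unfolding SGP_def by (intro CollectI exI[of _ "[j]"] exI[of _ "[a]"]) auto
next
  case (nest j d s a)
  then obtain js as where *: "s = (\<lambda>n. nested (map2 (\<lambda>j a. of_int n ^ j * a) js as))"
    "length js = length as" "1 \<le> length as" "length as \<le> d" "\<forall>j\<in>set js. j \<ge> 1" "sum_list js \<le> d"
    unfolding SGP_def by auto
  then have "js \<noteq> []" "as \<noteq> []" by auto
  with * nest show ?case
    unfolding SGP_def
    by (intro CollectI exI[of _ "j # js"] exI[of _ "a # as"]) (auto simp: nested_Cons zip_eq_Nil_iff)
qed

lemma nested_special_poly: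
  "length js = length as \<Longrightarrow> as \<noteq> [] \<Longrightarrow> \<forall>j\<in>set js. j \<ge> 1 \<Longrightarrow>
    special_poly (sum_list js) (\<lambda>n. nested (map2 (\<lambda>j a. of_int n ^ j * a) js as))"
proof (induction js as rule: list_induct2)
  case (Cons j js a as)
  show ?case
  proof (cases "as = []")
    case True
    with Cons show ?thesis by (auto intro: special_poly.monomial)
  next
    case False
    with Cons have "js \<noteq> []" by auto
    with False Cons show ?thesis
      by (auto simp: nested_Cons zip_eq_Nil_iff intro: special_poly.nest)
  qed
qed simp

lemma SGP_iff_special_poly: "s \<in> SGP d \<longleftrightarrow> special_poly d s"
proof
  assume "s \<in> SGP d"
  then obtain js as where "s = (\<lambda>n. nested (map2 (\<lambda>j a. of_int n ^ j * a) js as))"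
    "length js = length as" "1 \<le> length as" "\<forall>j\<in>set js. j \<ge> 1" "sum_list js \<le> d"
    unfolding SGP_def by blast
  moreover from this have "as \<noteq> []" by auto
  ultimately show "special_poly d s"
    using nested_special_poly special_poly_mono by blast
qed (rule special_poly_imp_SGP)

lemma GP_poly_power:
  assumes "1 \<le> d"
  shows "GP_poly d (\<lambda>n. of_int n ^ d * a)"
proof (cases "d = 1")
  case True
  then show ?thesis using GP_poly.linear[of a] by (simp add: mult.commute)
next
  case False
  with assms show ?thesis
    using GP_poly.product[of d 0 "\<lambda>_. d" "\<lambda>_ _. 0" a] by (simp add: mult.commute)
qed

lemma GP_poly_mono: "GP_poly i f \<Longrightarrow> i \<le> d \<Longrightarrow> GP_poly d f"
  by (cases "i = d") (auto intro: GP_poly.lower)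

lemma special_poly_imp_GP_poly: "special_poly d s \<Longrightarrow> GP_poly d s"
proof (induction rule: special_poly.induct)
  case (monomial j d a)
  then show ?case using GP_poly_power GP_poly_mono by blast
next
  case (nest j d s a)
  \<comment> \<open>Together with \<open>j >= 1\<close> this gives the bound
    \<open>j + d >= 2\<close> demanded by the rule \<open>product\<close>.\<close>
  have "1 \<le> d" using nest special_poly_pos by blast
  then show ?case
    using nest GP_poly.product[of "j + d" 1 "\<lambda>l. if l = 0 then j else d" "\<lambda>_. s" a]
    by (simp add: mult_ac)
qed

section \<open>The filter of special Bohr sets\<close>

definition special_filter :: "nat \<Rightarrow> int filter" where
  "special_filter d = (INF s\<in>SGP d. filtercomap (\<lambda>n. int_dist (s n)) (nhds 0))"

lemma special_filter_mono: "d \<le> d' \<Longrightarrow> special_filter d' \<le> special_filter d"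
  unfolding special_filter_def
  by (rule INF_superset_mono) (auto simp: SGP_iff_special_poly intro: special_poly_mono)

lemma tendsto_special_filter_mono:
  "(f \<longlongrightarrow> l) (special_filter d) \<Longrightarrow> d \<le> d' \<Longrightarrow> (f \<longlongrightarrow> l) (special_filter d')"
  using special_filter_mono tendsto_mono by blast

lemma special_poly_diff_nint_tendsto_0:
  assumes "special_poly d s"
  shows "((\<lambda>n. s n - of_int (nint (s n))) \<longlongrightarrow> 0) (special_filter d)"
proof -
  have "special_filter d \<le> filtercomap (\<lambda>n. int_dist (s n)) (nhds 0)"
    unfolding special_filter_def using assms by (intro INF_lower) (simp add: SGP_iff_special_poly)
  then have "((\<lambda>n. int_dist (s n)) \<longlongrightarrow> 0) (special_filter d)"
    using filterlim_filtercomap filterlim_mono by blast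
  then show ?thesis
    by (simp flip: abs_diff_nint add: tendsto_rabs_zero_iff)
qed

lemma family_of_finite:
  assumes "finite X" "X \<noteq> {}" "X \<subseteq> C" "\<And>s. s \<in> X \<Longrightarrow> \<delta> s > 0"
    and "(\<Inter>s\<in>X. {n. int_dist (s n) < \<delta> s}) \<subseteq> A"
  shows "A \<in> family_of C"
proof -
  obtain h where h: "bij_betw h {1..card X} X"
    using assms(1) ex_bij_betw_nat_finite_1 by blast
  have img: "h ` {1..card X} = X"
    using h by (simp add: bij_betw_def)
  have "card X \<ge> 1"
    using assms(1,2) by (simp add: Suc_leI card_gt_0_iff)
  moreover have "(\<Inter>i\<in>{1..card X}. {n. int_dist (h i n) < \<delta> (h i)}) \<subseteq> A"
    proof -
    have "(\<Inter>i\<in>{1..card X}. {n. int_dist (h i n) < \<delta> (h i)}) =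
        (\<Inter>s\<in>h ` {1..card X}. {n. int_dist (s n) < \<delta> s})" by simp
    with assms(5) img show ?thesis by metis
  qed
  moreover have "\<forall>i\<in>{1..card X}. h i \<in> C \<and> \<delta> (h i) > 0"
    using assms(3,4) img by blast
  ultimately show ?thesis
    unfolding family_of_def
    by (intro CollectI exI[of _ "card X"] exI[of _ h] exI[of _ "\<lambda>i. \<delta> (h i)"]) auto
qed

text \<open>An event of an infimum of filters already holds in the infimum over finitely many
  generators, and each generator contributes one condition
  \<open>int_dist (s n) < \<delta> s\<close>.\<close>

lemma eventually_special_filter_imp_F_SGP:
  assumes "1 \<le> d" "eventually (\<lambda>n. n \<in> A) (special_filter d)"
  shows "A \<in> F_SGP d"
proof -
  let ?F = "\<lambda>s. filtercomap (\<lambda>n. int_dist (s n)) (nhds 0)"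
  obtain X where X: "X \<subseteq> SGP d" "finite X" "eventually (\<lambda>n. n \<in> A) (INF s\<in>X. ?F s)"
    using assms(2)[unfolded special_filter_def, THEN eventually_INF[THEN iffD1]] by blast
  then obtain Q where Q: "\<forall>s\<in>X. eventually (Q s) (?F s)" "\<forall>n. (\<forall>s\<in>X. Q s n) \<longrightarrow> n \<in> A"
    by (auto simp: eventually_INF_finite)
  have "\<exists>\<delta>>0. \<forall>n. int_dist (s n) < \<delta> \<longrightarrow> Q s n" if "s \<in> X" for s
  proof -
    have "eventually (Q s) (?F s)" using Q that by blast
    then obtain R where R: "eventually R (nhds 0)" "\<And>n. R (int_dist (s n)) \<Longrightarrow> Q s n"
      unfolding eventually_filtercomap by blast
    then obtain \<delta> where "\<delta> > 0" "\<And>x. dist x 0 < \<delta> \<Longrightarrow> R x"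
      unfolding eventually_nhds_metric by blast
    with R show ?thesis
      by (intro exI[of _ \<delta>]) (auto simp: dist_real_def int_dist_nonneg)
  qed
  then obtain \<delta> where \<delta>: "\<And>s. s \<in> X \<Longrightarrow> \<delta> s > 0"
    "\<And>s n. s \<in> X \<Longrightarrow> int_dist (s n) < \<delta> s \<Longrightarrow> Q s n"
    by metis
  \<comment> \<open>\<open>X\<close> may be empty, but \<open>family_of\<close> asks for at least
    one function; the zero function adds a condition that always holds.\<close>
  define s0 :: "int \<Rightarrow> real" where "s0 = (\<lambda>n. of_int n ^ 1 * 0)"
  have "s0 \<in> SGP d"
    unfolding s0_def SGP_iff_special_poly using assms(1) by (intro special_poly.monomial) auto
  then show ?thesis
    unfolding F_SGP_def using X \<delta> Q(2)
    by (intro family_of_finite[of "insert s0 X" _ "\<lambda>s. if s \<in> X then \<delta> s else 1"]) auto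
qed

section \<open>Integer combinations of products of brackets\<close>

text \<open>The first index is one less than the largest number of brackets in a product.\<close>

inductive bracket_comb :: "nat \<Rightarrow> nat \<Rightarrow> (int \<Rightarrow> real) \<Rightarrow> bool" where
  bracket: "special_poly d s \<Longrightarrow> bracket_comb 0 d (\<lambda>n. of_int (nint (s n)))"
| mult: "bracket_comb m d v \<Longrightarrow> special_poly d' w \<Longrightarrow>
    bracket_comb (Suc m) (d + d') (\<lambda>n. v n * of_int (nint (w n)))"
| up: "bracket_comb m d v \<Longrightarrow> bracket_comb (Suc m) d v"
| add: "bracket_comb m d u \<Longrightarrow> bracket_comb m d v \<Longrightarrow> bracket_comb m d (\<lambda>n. u n + v n)"
| minus: "bracket_comb m d u \<Longrightarrow> bracket_comb m d (\<lambda>n. - u n)"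

lemma bracket_comb_Ints: "bracket_comb m d u \<Longrightarrow> u n \<in> \<int>"
  by (induction rule: bracket_comb.induct) auto

lemma bracket_comb_mono_deg: "bracket_comb m d u \<Longrightarrow> d \<le> d' \<Longrightarrow> bracket_comb m d' u"
proof (induction arbitrary: d' rule: bracket_comb.induct)
  case (mult m d v e w)
  then have "bracket_comb (Suc m) (d + (d' - d)) (\<lambda>n. v n * of_int (nint (w n)))"
    by (intro bracket_comb.mult special_poly_mono[OF mult(2)]) auto
  with mult.prems show ?case by simp
next
  case (bracket d s)
  then show ?case by (intro bracket_comb.bracket special_poly_mono[OF bracket(1)])
next
  case (up m d v)
  then show ?case by (intro bracket_comb.up)
next
  case (add m d u v)
  then show ?case by (intro bracket_comb.add)
next
  case (minus m d u)
  then show ?case by (intro bracket_comb.minus)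
qed

lemma bracket_comb_mono_num: "bracket_comb m d u \<Longrightarrow> m \<le> m' \<Longrightarrow> bracket_comb m' d u"
  by (rotate_tac 1, induction rule: dec_induct) (simp_all add: bracket_comb.up)

lemma bracket_comb_prod:
  assumes "bracket_comb m d u" "bracket_comb k e v"
  shows "\<exists>l. bracket_comb l (d + e) (\<lambda>n. u n * v n)"
  using assms(2)
proof (induction rule: bracket_comb.induct)
  case (bracket e s)
  then show ?case using bracket_comb.mult[OF assms(1)] by blast
next
  case (mult k e v e' w)
  then obtain l where "bracket_comb l (d + e) (\<lambda>n. u n * v n)" by blast
  from bracket_comb.mult[OF this mult(2)] show ?case by (auto simp: mult.assoc add.assoc)
next
  case (add k e v w)
  then obtain l l' where *: "bracket_comb l (d + e) (\<lambda>n. u n * v n)"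
    "bracket_comb l' (d + e) (\<lambda>n. u n * w n)" by blast
  have "bracket_comb (max l l') (d + e) (\<lambda>n. u n * v n + u n * w n)"
    by (intro bracket_comb.add bracket_comb_mono_num[OF *(1)] bracket_comb_mono_num[OF *(2)]) auto
  then show ?case by (auto simp: distrib_left)
next
  case (minus k e v)
  then obtain l where "bracket_comb l (d + e) (\<lambda>n. u n * v n)" by blast
  from bracket_comb.minus[OF this] show ?case by auto
qed

section \<open>Approximation by integer combinations up to o(1)\<close>

definition near_comb :: "nat \<Rightarrow> nat \<Rightarrow> (int \<Rightarrow> real) \<Rightarrow> bool" where
  "near_comb m d f \<longleftrightarrow>
    (\<exists>e. bracket_comb m d e \<and> ((\<lambda>n. f n - e n) \<longlongrightarrow> 0) (special_filter d))"

lemma near_comb_mono: "near_comb m d f \<Longrightarrow> m \<le> m' \<Longrightarrow> d \<le> d' \<Longrightarrow> near_comb m' d' f"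
  unfolding near_comb_def
  using bracket_comb_mono_num bracket_comb_mono_deg tendsto_special_filter_mono by meson

lemma near_comb_add:
  assumes "near_comb m d f" "near_comb m d g"
  shows "near_comb m d (\<lambda>n. f n + g n)"
proof -
  obtain e e' where *: "bracket_comb m d e" "((\<lambda>n. f n - e n) \<longlongrightarrow> 0) (special_filter d)"
    "bracket_comb m d e'" "((\<lambda>n. g n - e' n) \<longlongrightarrow> 0) (special_filter d)"
    using assms unfolding near_comb_def by blast
  have "((\<lambda>n. (f n + g n) - (e n + e' n)) \<longlongrightarrow> 0) (special_filter d)"
    using tendsto_add[OF *(2,4)] by (simp add: algebra_simps)
  with bracket_comb.add[OF *(1,3)] show ?thesis
    unfolding near_comb_def by blast
qed

lemma near_comb_minus:
  assumes "near_comb m d f"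
  shows "near_comb m d (\<lambda>n. - f n)"
proof -
  obtain e where *: "bracket_comb m d e" "((\<lambda>n. f n - e n) \<longlongrightarrow> 0) (special_filter d)"
    using assms unfolding near_comb_def by blast
  have "((\<lambda>n. - f n - - e n) \<longlongrightarrow> 0) (special_filter d)"
    using tendsto_minus[OF *(2)] by (simp add: algebra_simps)
  with bracket_comb.minus[OF *(1)] show ?thesis
    unfolding near_comb_def by blast
qed

lemma near_comb_diff:
  "near_comb m d f \<Longrightarrow> near_comb m d g \<Longrightarrow> near_comb m d (\<lambda>n. f n - g n)"
  using near_comb_add[OF _ near_comb_minus] by simp

lemma near_comb_approx:
  assumes "near_comb m d f" "((\<lambda>n. g n - f n) \<longlongrightarrow> 0) (special_filter d)"
  shows "near_comb m d g"
proof -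
  obtain e where *: "bracket_comb m d e" "((\<lambda>n. f n - e n) \<longlongrightarrow> 0) (special_filter d)"
    using assms unfolding near_comb_def by blast
  have "((\<lambda>n. g n - e n) \<longlongrightarrow> 0) (special_filter d)"
    using tendsto_add[OF *(2) assms(2)] by (simp add: algebra_simps)
  with * show ?thesis
    unfolding near_comb_def by blast
qed

lemma near_comb_cong:
  assumes "near_comb m d f" "eventually (\<lambda>n. g n = f n) (special_filter d)"
  shows "near_comb m d g"
proof (rule near_comb_approx[OF assms(1)])
  show "((\<lambda>n. g n - f n) \<longlongrightarrow> 0) (special_filter d)"
    by (rule tendsto_eventually) (use assms(2) in eventually_elim, simp)
qed

lemma bracket_comb_imp_near_comb: "bracket_comb m d f \<Longrightarrow> near_comb m d f"
  unfolding near_comb_def by (intro exI[of _ f]) auto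

lemma special_poly_near_comb:
  "special_poly d s \<Longrightarrow> near_comb 0 d s"
  unfolding near_comb_def
  using special_poly_diff_nint_tendsto_0 bracket_comb.bracket by blast

text \<open>For \<open>j > 0\<close> the function is itself special. For \<open>j = 0\<close> there
  is no power of \<open>n\<close> to form a new level, but the bracket may be replaced by
  \<open>s\<close> at the cost of o(1), and \<open>c * s\<close> is special.\<close>

lemma near_comb_scale_bracket:
  assumes "special_poly d s"
  shows "near_comb 0 (j + d) (\<lambda>n. c * of_int n ^ j * of_int (nint (s n)))"
proof (cases "j = 0")
  case True
  have "near_comb 0 d (\<lambda>n. c * s n)"
    by (rule special_poly_near_comb[OF special_poly_scale[OF assms]])
  moreover have "((\<lambda>n. c * of_int (nint (s n)) - c * s n) \<longlongrightarrow> 0) (special_filter d)"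
    using tendsto_mult_right_zero[OF special_poly_diff_nint_tendsto_0[OF assms], of "- c"]
    by (simp add: algebra_simps)
  ultimately show ?thesis using True near_comb_approx by simp
next
  case False
  then have "special_poly (j + d) (\<lambda>n. of_int n ^ j * c * of_int (nint (s n)))"
    using assms by (intro special_poly.nest) auto
  then show ?thesis
    using special_poly_near_comb by (simp add: mult_ac)
qed

text \<open>\<open>IH\<close> covers products with one bracket fewer. The proof is an induction on
  the nesting of the last factor \<open>w\<close>.\<close>

lemma near_comb_scale_mult:
  assumes IH: "\<And>d u j c. bracket_comb m d u \<Longrightarrow> near_comb m (j + d) (\<lambda>n. c * of_int n ^ j * u n)"
    and "special_poly d' w" "bracket_comb m d v"
  shows "near_comb (Suc m) (j + d + d') (\<lambda>n. c * of_int n ^ j * v n * of_int (nint (w n)))"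
proof -
  \<comment> \<open>Shared by both cases: it suffices to treat \<open>w\<close> without its outer
    bracket. The premise \<open>tail\<close> ranges over all \<open>d v j c\<close> because it is
    applied both to \<open>v\<close> and to the approximant \<open>e\<close>.\<close>
  have reduce: "near_comb (Suc m) (j + d + d') (\<lambda>n. c * of_int n ^ j * v n * of_int (nint (w n)))"
    if w: "special_poly d' w" and v: "bracket_comb m d v"
      and tail: "\<And>d v j c. bracket_comb m d v \<Longrightarrow>
        near_comb (Suc m) (j + d + d') (\<lambda>n. c * of_int n ^ j * v n * w n)"
    for d' w d v j c
  proof -
    let ?V = "\<lambda>n. c * of_int n ^ j * v n"
    obtain e where e: "bracket_comb m (j + d) e"
      "((\<lambda>n. ?V n - e n) \<longlongrightarrow> 0) (special_filter (j + d))"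
      using IH[OF v] unfolding near_comb_def by blast
    have "((\<lambda>n. - ((?V n - e n) * (w n - of_int (nint (w n))))) \<longlongrightarrow> 0) (special_filter (j + d + d'))"
      using tendsto_mult[OF tendsto_special_filter_mono[OF e(2)]
          tendsto_special_filter_mono[OF special_poly_diff_nint_tendsto_0[OF w]], of "j + d + d'"]
      by (auto dest: tendsto_minus)
    \<comment> \<open>The difference equals \<open>- (V - e) * (w - nint w)\<close> identically, a
      product of two o(1) terms.\<close>
    then have approx: "((\<lambda>n. ?V n * of_int (nint (w n)) -
        (?V n * w n + e n * of_int (nint (w n)) - e n * w n)) \<longlongrightarrow> 0) (special_filter (j + d + d'))"
      by (rule Lim_transform_eventually) (auto simp: algebra_simps)
    have Vw: "near_comb (Suc m) (j + d + d') (\<lambda>n. ?V n * w n)"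
      using tail[OF v] by simp
    have ew': "near_comb (Suc m) (j + d + d') (\<lambda>n. e n * of_int (nint (w n)))"
      by (intro bracket_comb_imp_near_comb bracket_comb.mult e w)
    have ew: "near_comb (Suc m) (j + d + d') (\<lambda>n. e n * w n)"
      using tail[OF e(1), of 0 1] by simp
    show ?thesis
      by (rule near_comb_approx[OF near_comb_diff[OF near_comb_add[OF Vw ew'] ew] approx])
  qed
  from assms(2,3) show ?thesis
  proof (induction arbitrary: d v j c rule: special_poly.induct)
    case (monomial i d' b)
    show ?case
    proof (rule reduce)
      show "special_poly d' (\<lambda>n. of_int n ^ i * b)"
        using monomial by (intro special_poly.monomial)
      fix d v j c assume "bracket_comb m d v"
      \<comment> \<open>The monomial merges with the coefficient and the power of \<open>n\<close>,
        so only the brackets of \<open>v\<close> remain.\<close>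
      from IH[OF this, of "i + j" "c * b"]
      have "near_comb (Suc m) (j + d + d') (\<lambda>n. c * b * of_int n ^ (i + j) * v n)"
        by (rule near_comb_mono) (use monomial in auto)
      then show "near_comb (Suc m) (j + d + d') (\<lambda>n. c * of_int n ^ j * v n * (of_int n ^ i * b))"
        by (simp add: power_add mult_ac)
    qed (rule monomial)
  next
    case (nest i d' t b)
    show ?case
    proof (rule reduce)
      show "special_poly (i + d') (\<lambda>n. of_int n ^ i * b * of_int (nint (t n)))"
        using nest by (intro special_poly.nest)
      fix d v j c assume "bracket_comb m d v"
      \<comment> \<open>Once the outer monomial is merged in front, the last bracket is that of
        \<open>t\<close>, nested less deeply.\<close>
      from nest.IH[OF this, of "i + j" "c * b"]
      show "near_comb (Suc m) (j + d + (i + d'))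
          (\<lambda>n. c * of_int n ^ j * v n * (of_int n ^ i * b * of_int (nint (t n))))"
        by (simp add: power_add mult_ac add_ac)
    qed (rule nest)
  qed
qed

text \<open>Outer induction on the number of brackets, inner one on the combination. Arbitrary
  \<open>c\<close> and \<open>j\<close> let the induction absorb monomials split off from a last
  factor; \<open>j = 0\<close> is plain real scaling.\<close>

lemma near_comb_scale:
  "bracket_comb m d u \<Longrightarrow> near_comb m (j + d) (\<lambda>n. c * of_int n ^ j * u n)"
proof (induction m arbitrary: d u j c)
  case 0
  then show ?case
  proof (induction "0::nat" d u rule: bracket_comb.induct)
    case (add d u v)
    then show ?case using near_comb_add by (simp add: distrib_left)
  next
    case (minus d u)
    then show ?case using near_comb_minus by simp
  qed (auto intro: near_comb_scale_bracket)
next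
  case (Suc m)
  from Suc.prems show ?case
  proof (induction "Suc m" d u rule: bracket_comb.induct)
    case (mult d v d' w)
    then show ?case
      using near_comb_scale_mult[OF Suc.IH] by (simp add: mult.assoc add.assoc)
  next
    case (up d v)
    show ?case by (rule near_comb_mono[OF Suc.IH[OF up(1)]]) auto
  next
    case (add d u v)
    then show ?case using near_comb_add by (simp add: distrib_left)
  next
    case (minus d u)
    then show ?case using near_comb_minus by simp
  qed
qed

section \<open>Approximation of generalized polynomials\<close>

text \<open>Since \<open>e\<close> is integer valued, an error below 1/2 forces the nearest integer
  to be \<open>e\<close> exactly.\<close>

lemma near_comb_nint:
  assumes "near_comb m d f"
  shows "\<exists>e. bracket_comb m d e \<and> eventually (\<lambda>n. of_int (nint (f n)) = e n) (special_filter d)"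
proof -
  obtain e where e: "bracket_comb m d e" "((\<lambda>n. f n - e n) \<longlongrightarrow> 0) (special_filter d)"
    using assms unfolding near_comb_def by blast
  have "eventually (\<lambda>n. \<bar>f n - e n\<bar> < 1 / 2) (special_filter d)"
    using tendstoD[OF e(2), of "1 / 2"] by simp
  then have "eventually (\<lambda>n. of_int (nint (f n)) = e n) (special_filter d)"
  proof eventually_elim
    case (elim n)
    obtain k where "e n = of_int k"
      using bracket_comb_Ints[OF e(1)] by (auto elim: Ints_cases)
    with elim nint_unique show ?case by simp
  qed
  with e show ?thesis by blast
qed

text \<open>Brackets eventually equal their approximants, so they can be multiplied although the
  factors may be unbounded; errors that are merely o(1) would not allow this.\<close>

lemma prod_nint_eventually_bracket_comb:
  fixes k :: nat
  assumes "k \<ge> 1" "\<And>l. l \<in> {1..k} \<Longrightarrow> \<exists>m. near_comb m (p l) (f l)"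
  shows "\<exists>m e. bracket_comb m (\<Sum>l=1..k. p l) e \<and>
    eventually (\<lambda>n. (\<Prod>l=1..k. of_int (nint (f l n))) = e n) (special_filter (\<Sum>l=1..k. p l))"
  using assms
proof (induction k rule: nat_induct_at_least)
  case base
  then show ?case using near_comb_nint by fastforce
next
  case (Suc k)
  let ?p = "\<Sum>l=1..k. p l"
  obtain m e where e: "bracket_comb m ?p e"
    "eventually (\<lambda>n. (\<Prod>l=1..k. of_int (nint (f l n))) = e n) (special_filter ?p)"
    using Suc by force
  obtain m' where "near_comb m' (p (Suc k)) (f (Suc k))"
    using Suc.prems[of "Suc k"] by auto
  then obtain e' where e': "bracket_comb m' (p (Suc k)) e'"
    "eventually (\<lambda>n. of_int (nint (f (Suc k) n)) = e' n) (special_filter (p (Suc k)))"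
    using near_comb_nint by blast
  obtain l where l: "bracket_comb l (?p + p (Suc k)) (\<lambda>n. e n * e' n)"
    using bracket_comb_prod e(1) e'(1) by blast
  have "eventually (\<lambda>n. (\<Prod>l=1..Suc k. of_int (nint (f l n))) = e n * e' n)
      (special_filter (?p + p (Suc k)))"
    using filter_leD[OF special_filter_mono e(2), of "?p + p (Suc k)", OF le_add1]
      filter_leD[OF special_filter_mono e'(2), of "?p + p (Suc k)", OF le_add2]
    by eventually_elim simp
  with l show ?case by auto
qed

text \<open>Carrying the factor \<open>c\<close> makes the case \<open>scale\<close> immediate.
  Under a bracket the hypothesis is used with \<open>c = 1\<close>, and
  \<open>near_comb_scale\<close> restores the coefficient afterwards.\<close>

lemma GP_poly_near_comb: "GP_poly d f \<Longrightarrow> \<exists>m. near_comb m d (\<lambda>n. c * f n)"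
proof (induction arbitrary: c rule: GP_poly.induct)
  case (linear a)
  have "special_poly 1 (\<lambda>n. of_int n ^ 1 * (c * a))"
    by (intro special_poly.monomial) auto
  from special_poly_near_comb[OF this] show ?case by (auto simp: mult_ac)
next
  case (lower i f d)
  then show ?case using near_comb_mono less_imp_le by blast
next
  case (product d k p f a)
  let ?p = "\<Sum>l=1..k. p l"
  have d: "d = p 0 + ?p"
    using product.hyps(2) by (simp add: sum.atLeast_Suc_atMost)
  show ?case
  proof (cases "k = 0")
    case True
    \<comment> \<open>Here \<open>p 0 = d\<close>, so the exponent is positive as
      \<open>monomial\<close> requires.\<close>
    then have "special_poly d (\<lambda>n. of_int n ^ p 0 * (c * a))"
      using product d by (intro special_poly.monomial) auto
    from special_poly_near_comb[OF this] True show ?thesis by (auto simp: mult_ac)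
  next
    case False
    have "\<exists>m. near_comb m (p l) (f l)" if "l \<in> {1..k}" for l
      using product.IH that by (metis (no_types, lifting) ext mult_1)
    then obtain m e where e: "bracket_comb m ?p e"
      "eventually (\<lambda>n. (\<Prod>l=1..k. of_int (nint (f l n))) = e n) (special_filter ?p)"
      using prod_nint_eventually_bracket_comb[of k p f] False by auto
    have "near_comb m d (\<lambda>n. c * a * of_int n ^ p 0 * e n)"
      unfolding d by (rule near_comb_scale[OF e(1)])
    moreover have "eventually (\<lambda>n. c * (a * of_int n ^ p 0 * (\<Prod>l=1..k. of_int (nint (f l n)))) =
        c * a * of_int n ^ p 0 * e n) (special_filter d)"
      using filter_leD[OF special_filter_mono e(2), of d, unfolded d, OF le_add2] unfolding d
      by eventually_elim simp
    ultimately show ?thesis by (intro exI[of _ m]) (rule near_comb_cong)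
  qed
next
  case (nearest d f)
  then obtain m where "near_comb m d f"
    by (metis (no_types, lifting) ext mult_1)
  then obtain e where e: "bracket_comb m d e"
    "eventually (\<lambda>n. of_int (nint (f n)) = e n) (special_filter d)"
    using near_comb_nint by blast
  have "near_comb m d (\<lambda>n. c * e n)"
    using near_comb_scale[OF e(1), of 0] by simp
  moreover have "eventually (\<lambda>n. c * of_int (nint (f n)) = c * e n) (special_filter d)"
    using e(2) by eventually_elim simp
  ultimately show ?case by (intro exI[of _ m]) (rule near_comb_cong)
next
  case (scale d f b)
  from scale.IH[of "c * b"] show ?case by (simp add: mult.assoc)
next
  case (add d f g)
  then obtain m m' where *: "near_comb m d (\<lambda>n. c * f n)" "near_comb m' d (\<lambda>n. c * g n)"
    by blast
  have "near_comb (max m m') d (\<lambda>n. c * f n + c * g n)"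
    by (intro near_comb_add near_comb_mono[OF *(1)] near_comb_mono[OF *(2)]) auto
  then show ?case by (auto simp: distrib_left)
qed

lemma GP_poly_eventually_int_dist_less:
  assumes "GP_poly d f" "\<epsilon> > 0"
  shows "eventually (\<lambda>n. int_dist (f n) < \<epsilon>) (special_filter d)"
proof -
  obtain m e where e: "bracket_comb m d e" "((\<lambda>n. f n - e n) \<longlongrightarrow> 0) (special_filter d)"
    using GP_poly_near_comb[OF assms(1), of 1] by (auto simp: near_comb_def)
  have "eventually (\<lambda>n. \<bar>f n - e n\<bar> < \<epsilon>) (special_filter d)"
    using tendstoD[OF e(2) assms(2)] by simp
  then show ?thesis
  proof eventually_elim
    case (elim n)
    obtain k where "e n = of_int k"
      using bracket_comb_Ints[OF e(1)] by (auto elim: Ints_cases)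
    with elim int_dist_le[of "f n" k] show ?case by simp
  qed
qed

theorem theorem4p2p11:
  fixes d :: nat
  assumes "d \<ge> 1"
  shows "F_GP d = F_SGP d"
proof
  show "F_GP d \<subseteq> F_SGP d"
  proof
    fix A assume "A \<in> F_GP d"
    then obtain k P \<epsilon> where *: "\<forall>i\<in>{1..k::nat}. P i \<in> GP d \<and> \<epsilon> i > 0"
      "(\<Inter>i\<in>{1..k}. {n. int_dist (P i n) < \<epsilon> i}) \<subseteq> A"
      unfolding F_GP_def family_of_def by blast
    have "eventually (\<lambda>n. \<forall>i\<in>{1..k}. int_dist (P i n) < \<epsilon> i) (special_filter d)"
      using *(1) by (intro eventually_ball_finite ballI GP_poly_eventually_int_dist_less)
        (auto simp: GP_def)
    then have "eventually (\<lambda>n. n \<in> A) (special_filter d)"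
      by (rule eventually_mono) (use *(2) in auto)
    then show "A \<in> F_SGP d"
      by (rule eventually_special_filter_imp_F_SGP[OF assms])
  qed
  have "SGP d \<subseteq> GP d"
    by (auto simp: SGP_iff_special_poly GP_def special_poly_imp_GP_poly)
  then show "F_SGP d \<subseteq> F_GP d"
    unfolding F_SGP_def F_GP_def family_of_def by blast
qed

end
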